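(* If $T$ is a tree with $\operatorname{diam}(T)\geq 5$, then $\operatorname{con}(T\overline{T})=\max\{n(T),\,2\Delta(T)+1\}$.
   Context: For a graph $G$ with complement $\overline{G}$, the complementary prism $G\overline{G}$ is the graph obtained from the disjoint union of $G$ and $\overline{G}$ by adding the perfect matching joining each vertex $v$ of $G$ to its copy $\overline{v}$ in $\overline{G}$. For a graph $H$, a set $S\subseteq V(H)$ is (geodesically) convex if every vertex on every shortest path between two vertices of $S$ belongs to $S$. The convexity number $\operatorname{con}(H)$ is the maximum cardinality of a proper (i.e. $\neq V(H)$) convex set of $H$. $n(T)=|V(T)|$ and $\Delta(T)$ is the maximum degree of $T$. *)

theory Defs
  imports "Graph_Theory.Graph_Theory"
begin

text \<open>
  A finite simple graph is a \<^locale>\<open>pair_graph\<close>: a finite, loop-free, symmetric set of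
  arcs on a finite vertex set, each edge being represented by its two orientations.
\<close>

text \<open>
  The library predicate \<^const>\<open>tree\<close> cannot be used here: in a symmetric digraph the walk
  a, b, a counts as a \<^const>\<open>pre_digraph.cycle\<close>. The cycles of length at least 3 are
  exactly the cycles of the undirected graph.
\<close>

definition simple_tree :: "'a pair_pre_digraph \<Rightarrow> bool" where
  "simple_tree T \<longleftrightarrow> pair_graph T \<and> Digraph_Component.connected (with_proj T) \<and>
     \<not> (\<exists>p. pre_digraph.cycle (with_proj T) p \<and> 3 \<le> length p)"

text \<open>By symmetry, \<^const>\<open>out_degree\<close> is the degree of the undirected graph.\<close>

definition max_degree :: "'a pair_pre_digraph \<Rightarrow> nat" where
  "max_degree G = Max ((\<lambda>v. out_degree (with_proj G) v) ` pverts G)"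

definition graph_dist :: "'a pair_pre_digraph \<Rightarrow> 'a \<Rightarrow> 'a \<Rightarrow> ereal" where
  "graph_dist G u v = wf_digraph.\<mu> (with_proj G) (\<lambda>_. 1) u v"

definition graph_diam :: "'a pair_pre_digraph \<Rightarrow> ereal" where
  "graph_diam G = (SUP u\<in>pverts G. SUP v\<in>pverts G. graph_dist G u v)"

definition shortest_path ::
  "'a pair_pre_digraph \<Rightarrow> 'a \<Rightarrow> ('a \<times> 'a) awalk \<Rightarrow> 'a \<Rightarrow> bool" where
  "shortest_path G u p v \<longleftrightarrow>
     pre_digraph.apath (with_proj G) u p v \<and> ereal (real (length p)) = graph_dist G u v"

definition geodesically_convex :: "'a pair_pre_digraph \<Rightarrow> 'a set \<Rightarrow> bool" where
  "geodesically_convex H S \<longleftrightarrow> S \<subseteq> pverts H \<and>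
     (\<forall>u\<in>S. \<forall>v\<in>S. \<forall>p. shortest_path H u p v \<longrightarrow> set (pawalk_verts u p) \<subseteq> S)"

definition convexity_number :: "'a pair_pre_digraph \<Rightarrow> nat" where
  "convexity_number H = Max {card S | S. geodesically_convex H S \<and> S \<noteq> pverts H}"

definition graph_complement :: "'a pair_pre_digraph \<Rightarrow> 'a pair_pre_digraph" where
  "graph_complement G =
     \<lparr> pverts = pverts G,
       parcs = {(u, v). u \<in> pverts G \<and> v \<in> pverts G \<and> u \<noteq> v \<and> (u, v) \<notin> parcs G} \<rparr>"

text \<open>\<^term>\<open>Inl v\<close> is the vertex v of G, and \<^term>\<open>Inr v\<close> its copy in the complement of G.\<close>

definition complementary_prism :: "'a pair_pre_digraph \<Rightarrow> ('a + 'a) pair_pre_digraph" where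
  "complementary_prism G =
     \<lparr> pverts = pverts G <+> pverts (graph_complement G),
       parcs = map_prod Inl Inl ` parcs G
         \<union> map_prod Inr Inr ` parcs (graph_complement G)
         \<union> {(Inl v, Inr v) | v. v \<in> pverts G}
         \<union> {(Inr v, Inl v) | v. v \<in> pverts G} \<rparr>"

lemma pair_graph_complement:
  assumes "pair_graph G"
  shows "pair_graph (graph_complement G)"
proof -
  interpret G: pair_graph G by fact
  have fin: "finite (pverts G)" by (rule G.pair_finite_verts)
  have arcs: "finite (parcs (graph_complement G))"
    by (rule finite_subset[of _ "pverts G \<times> pverts G"])
       (auto simp: graph_complement_def fin)
  show ?thesis
    by unfold_locales
       (use fin arcs G.arcs_symmetric in
         \<open>auto simp: graph_complement_def symmetric_def intro!: symI\<close>)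
qed

lemma pair_graph_complementary_prism:
  assumes "pair_graph G"
  shows "pair_graph (complementary_prism G)"
proof -
  interpret G: pair_graph G by fact
  interpret C: pair_graph "graph_complement G"
    by (rule pair_graph_complement) fact
  have vC: "pverts (graph_complement G) = pverts G"
    by (simp add: graph_complement_def)
  have arcs: "finite (parcs (complementary_prism G))"
    by (simp add: complementary_prism_def G.pair_finite_arcs C.pair_finite_arcs
        G.pair_finite_verts)
  have sym: "sym (parcs (complementary_prism G))"
    by (rule symI)
       (auto simp: complementary_prism_def image_iff map_prod_def
         dest: G.arcs_symmetric C.arcs_symmetric
         split: prod.splits intro: rev_bexI)
  show ?thesis
    by unfold_locales
       (use arcs sym G.pair_finite_verts in
         \<open>auto simp: complementary_prism_def symmetric_def vC
           dest: G.in_arcsD1 G.in_arcsD2 C.in_arcsD1[unfolded vC] C.in_arcsD2[unfolded vC]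
             G.no_loops' C.no_loops'\<close>)
qed

lemma graph_dist_eq:
  assumes "pair_graph G"
  shows "graph_dist G u v =
    (INF p\<in>{p. pre_digraph.awalk (with_proj G) u p v}. ereal (real (length p)))"
proof -
  interpret G: pair_graph G by fact
  have "G.awalk_cost (\<lambda>_. 1) p = real (length p)" for p
    by (induction p) simp_all
  then show ?thesis
    by (simp add: graph_dist_def G.\<mu>_def)
qed

end

theory Submission
  imports Defs
begin

text \<open>
  Of the tree only connectedness, the absence of triangles and squares, and the existence of a
  vertex at distance at least 3 from any given one are needed. Let a convex set consist of the
  vertices in \<open>A\<close> and the copies of the vertices in \<open>B\<close>. A vertex of \<open>A - B\<close> is adjacent to
  all of \<open>B\<close>, so if \<open>B\<close> has at least two elements, there is at most one such vertex \<open>a\<close>, and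
  the star around \<open>a\<close> gives the bound \<open>2 \<Delta> + 1\<close>. If \<open>A \<subseteq> B\<close> and \<open>A\<close> is independent, choosing
  a neighbour of each vertex of \<open>A\<close> injects \<open>A\<close> into the complement of \<open>B\<close>, which gives the bound
  \<open>n\<close>. Finally, an edge \<open>uw\<close> in \<open>A \<subseteq> B\<close> forces all common non-neighbours of \<open>u\<close> and \<open>w\<close>
  into \<open>B\<close>, which spreads to the whole prism unless \<open>A = {u, w}\<close> and \<open>B\<close> misses at least two
  vertices.
\<close>

section \<open>Short geodesics\<close>

context pair_graph
begin

lemma shortest_path_iff:
  "shortest_path G u p v \<longleftrightarrow> apath u p v \<and> (\<forall>q. awalk u q v \<longrightarrow> length p \<le> length q)"
proof
  assume sp: "shortest_path G u p v"
  have "length p \<le> length q" if "awalk u q v" for q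
  proof -
    have "ereal (real (length p)) = (INF q\<in>{q. awalk u q v}. ereal (real (length q)))"
      using sp by (simp add: shortest_path_def graph_dist_eq[OF pair_graph])
    also have "\<dots> \<le> ereal (real (length q))" by (rule INF_lower) (simp add: that)
    finally show ?thesis by simp
  qed
  then show "apath u p v \<and> (\<forall>q. awalk u q v \<longrightarrow> length p \<le> length q)"
    using sp by (simp add: shortest_path_def)
next
  assume *: "apath u p v \<and> (\<forall>q. awalk u q v \<longrightarrow> length p \<le> length q)"
  have "(INF q\<in>{q. awalk u q v}. ereal (real (length q))) = ereal (real (length p))"
    using * by (intro antisym INF_lower2[of p] INF_greatest) (auto simp: apath_def)
  with * show "shortest_path G u p v"
    by (simp add: shortest_path_def graph_dist_eq[OF pair_graph])
qed

lemma awalk_short: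
  assumes "awalk u q v"
  shows "length q = 0 \<Longrightarrow> u = v"
    and "length q = 1 \<Longrightarrow> (u, v) \<in> parcs G"
    and "length q = 2 \<Longrightarrow> \<exists>x. (u, x) \<in> parcs G \<and> (x, v) \<in> parcs G"
  using assms by (auto simp: length_Suc_conv numeral_2_eq_2 awalk_simps)

lemma geodesically_convex_middle:
  assumes "geodesically_convex G S" "u \<in> S" "v \<in> S" "u \<noteq> v" "(u, v) \<notin> parcs G"
    and "(u, x) \<in> parcs G" "(x, v) \<in> parcs G"
  shows "x \<in> S"
proof -
  let ?p = "[(u, x), (x, v)]"
  have "length ?p \<le> length q" if "awalk u q v" for q
  proof (rule ccontr)
    assume "\<not> ?thesis"
    then have "length q < 2" by simp
    then have "length q = 0 \<or> length q = 1" by linarith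
    then show False using awalk_short[OF that] assms(4,5) by blast
  qed
  moreover have "apath u ?p v"
    using assms no_loops' in_arcsD1 in_arcsD2 by (auto simp: apath_simps)
  ultimately have "shortest_path G u ?p v" by (simp add: shortest_path_iff)
  then have "set (pawalk_verts u ?p) \<subseteq> S"
    using assms unfolding geodesically_convex_def by blast
  then show ?thesis by simp
qed

text \<open>The premises exclude walks of length 0, 1 and 2 from \<open>u\<close> to
  \<open>v\<close>, so the three-arc path is a geodesic. Exchanging the ends gives the other inner
  vertex.\<close>

lemma geodesically_convex_middle3:
  assumes "geodesically_convex G S" "u \<in> S" "v \<in> S" "u \<noteq> v" "(u, v) \<notin> parcs G"
    and "\<And>z. (u, z) \<in> parcs G \<Longrightarrow> (z, v) \<notin> parcs G"
    and "(u, x) \<in> parcs G" "(x, y) \<in> parcs G" "(y, v) \<in> parcs G"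
  shows "x \<in> S"
proof -
  let ?p = "[(u, x), (x, y), (y, v)]"
  have "length ?p \<le> length q" if "awalk u q v" for q
  proof (rule ccontr)
    assume "\<not> ?thesis"
    then have "length q < 3" by simp
    then have "length q = 0 \<or> length q = 1 \<or> length q = 2" by linarith
    then show False using awalk_short[OF that] assms(4-6) by blast
  qed
  moreover have "u \<noteq> y" "x \<noteq> v" using assms by blast+
  then have "apath u ?p v"
    using assms no_loops' in_arcsD1 in_arcsD2 by (auto simp: apath_simps)
  ultimately have "shortest_path G u ?p v" by (simp add: shortest_path_iff)
  then have "set (pawalk_verts u ?p) \<subseteq> S"
    using assms unfolding geodesically_convex_def by blast
  then show ?thesis by simp
qed

text \<open>Premise \<open>near\<close> keeps distances between members of \<open>S\<close> at most
  2, so only geodesics of length 2 have an inner vertex, and \<open>middle\<close> covers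
  these.\<close>

lemma geodesically_convexI:
  assumes "S \<subseteq> pverts G"
    and near: "\<And>u v. \<lbrakk>u \<in> S; v \<in> S; u \<noteq> v; (u, v) \<notin> parcs G\<rbrakk>
      \<Longrightarrow> \<exists>x. (u, x) \<in> parcs G \<and> (x, v) \<in> parcs G"
    and middle: "\<And>u v x. \<lbrakk>u \<in> S; v \<in> S; u \<noteq> v; (u, v) \<notin> parcs G; (u, x) \<in> parcs G;
      (x, v) \<in> parcs G\<rbrakk> \<Longrightarrow> x \<in> S"
  shows "geodesically_convex G S"
  unfolding geodesically_convex_def
proof (intro conjI ballI allI impI)
  show "S \<subseteq> pverts G" by fact
next
  fix u v p assume uv: "u \<in> S" "v \<in> S" and sp: "shortest_path G u p v"
  then have ap: "apath u p v" and min: "\<And>q. awalk u q v \<Longrightarrow> length p \<le> length q"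
    by (simp_all add: shortest_path_iff)
  have V: "u \<in> pverts G" "v \<in> pverts G" using uv assms(1) by auto
  consider "u = v" | "(u, v) \<in> parcs G" | "u \<noteq> v" "(u, v) \<notin> parcs G" by blast
  then show "set (pawalk_verts u p) \<subseteq> S"
  proof cases
    case 1
    then have "p = []" using min[of "[]"] V by (simp add: awalk_simps)
    then show ?thesis using uv by simp
  next
    case 2
    then have "length p \<le> 1" using min[of "[(u, v)]"] V by (simp add: awalk_simps)
    then have "p = [] \<or> (\<exists>e. p = [e])" by (cases p) auto
    then show ?thesis using uv ap by (auto simp: apath_simps)
  next
    case 3
    then obtain x where "(u, x) \<in> parcs G" "(x, v) \<in> parcs G" using near uv by blast
    then have "length p \<le> 2" using min[of "[(u, x), (x, v)]"] V by (simp add: awalk_simps)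
    then consider "p = []" | e where "p = [e]" | e f where "p = [e, f]"
      by (auto simp: le_less numeral_2_eq_2 less_Suc_eq length_Suc_conv)
    then show ?thesis
    proof cases
      case (3 e f)
      then have "fst e = u" "(u, snd e) \<in> parcs G" "(snd e, v) \<in> parcs G"
        "snd e = fst f" "snd f = v"
        using ap by (cases e; cases f; auto simp: apath_simps)+
      then show ?thesis
        using middle[of u v "snd e"] uv 3 \<open>u \<noteq> v\<close> \<open>(u, v) \<notin> parcs G\<close> by simp
    qed (use uv ap in \<open>auto simp: apath_simps\<close>)
  qed
qed

section \<open>Vertices at distance at least three\<close>

definition far :: "'a \<Rightarrow> 'a \<Rightarrow> bool" where
  "far u v \<longleftrightarrow> u \<noteq> v \<and> (u, v) \<notin> parcs G \<and> (\<forall>x. (u, x) \<in> parcs G \<longrightarrow> (x, v) \<notin> parcs G)"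

lemma far_sym: "far u v \<longleftrightarrow> far v u"
  unfolding far_def using arcs_symmetric by blast

lemma not_far_awalk:
  assumes "u \<in> pverts G" "v \<in> pverts G" "\<not> far u v"
  shows "\<exists>p. awalk u p v \<and> length p \<le> 2"
proof -
  consider "u = v" | "(u, v) \<in> parcs G"
    | x where "(u, x) \<in> parcs G" "(x, v) \<in> parcs G"
    using assms(3) unfolding far_def by blast
  then show ?thesis
  proof cases
    case 1
    then show ?thesis using assms by (intro exI[of _ "[]"]) (simp add: awalk_simps)
  next
    case 2
    then show ?thesis using assms by (intro exI[of _ "[(u, v)]"]) (simp add: awalk_simps)
  next
    case 3
    then show ?thesis using assms
      by (intro exI[of _ "[(u, x), (x, v)]"]) (simp add: awalk_simps)
  qed
qed

text \<open>If nothing were far from \<open>x\<close>, any two vertices would be joined through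
  \<open>x\<close> by a walk of length at most 2 + 2 = 4.\<close>

lemma ex_far_if_diam:
  assumes "5 \<le> graph_diam G" "x \<in> pverts G"
  shows "\<exists>y\<in>pverts G. far x y"
proof (rule ccontr)
  assume no: "\<not> ?thesis"
  \<comment> \<open>A strict lower bound on a supremum is exceeded by one of its terms, which yields
    an actual pair \<open>u\<close>, \<open>v\<close>.\<close>
  have "4 < graph_diam G" by (rule less_le_trans[OF _ assms(1)]) simp
  then obtain u v where uv: "u \<in> pverts G" "v \<in> pverts G" and d: "4 < graph_dist G u v"
    unfolding graph_diam_def by (auto simp: less_SUP_iff)
  obtain p q where p: "awalk u p x" "length p \<le> 2" and q: "awalk x q v" "length q \<le> 2"
    using no not_far_awalk uv assms(2) far_sym by meson
  have "graph_dist G u v \<le> ereal (real (length (p @ q)))"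
    unfolding graph_dist_eq[OF pair_graph]
    by (rule INF_lower) (use awalk_appendI[OF p(1) q(1)] in simp)
  also have "\<dots> \<le> ereal 4" using p(2) q(2) by simp
  finally show False using d by simp
qed

end

section \<open>The two coordinates of a convex set of the prism\<close>

locale wide_graph = pair_graph T for T :: "'a pair_pre_digraph" +
  assumes connected: "\<lbrakk>u \<in> pverts T; v \<in> pverts T\<rbrakk> \<Longrightarrow> u \<rightarrow>\<^sup>*\<^bsub>with_proj T\<^esub> v"
    and nonempty: "pverts T \<noteq> {}"
    and no_triangle: "\<lbrakk>(a, b) \<in> parcs T; (b, c) \<in> parcs T\<rbrakk> \<Longrightarrow> (a, c) \<notin> parcs T"
    and no_square: "\<lbrakk>(a, b) \<in> parcs T; (b, c) \<in> parcs T; (a, d) \<in> parcs T; (d, c) \<in> parcs T;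
      a \<noteq> c\<rbrakk> \<Longrightarrow> b = d"
    and ex_far: "x \<in> pverts T \<Longrightarrow> \<exists>y\<in>pverts T. far x y"
begin

lemma ex_neighbour:
  assumes "x \<in> pverts T"
  shows "\<exists>y. (x, y) \<in> parcs T"
proof -
  obtain z where "z \<in> pverts T" "x \<noteq> z" using ex_far[OF assms] by (auto simp: far_def)
  then obtain p where p: "awalk x p z" using connected[OF assms] reachable_awalk by blast
  with \<open>x \<noteq> z\<close> show ?thesis by (cases p) (auto simp: awalk_simps)
qed

lemma closed_eq_verts:
  assumes "A \<subseteq> pverts T" "A \<noteq> {}" "\<And>u v. \<lbrakk>u \<in> A; (u, v) \<in> parcs T\<rbrakk> \<Longrightarrow> v \<in> A"
  shows "A = pverts T"
proof -
  obtain a where a: "a \<in> A" using assms(2) by blast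
  have "v \<in> A" if "v \<in> pverts T" for v
  proof -
    have "a \<rightarrow>\<^sup>*\<^bsub>with_proj T\<^esub> v" using connected a assms(1) that by blast
    then show ?thesis by (induction rule: reachable_induct) (use a assms(3) in auto)
  qed
  then show ?thesis using assms(1) by blast
qed

lemma out_degree_eq: "out_degree (with_proj T) v = card {w. (v, w) \<in> parcs T}"
proof -
  have "out_arcs (with_proj T) v = Pair v ` {w. (v, w) \<in> parcs T}"
    by (auto simp: out_arcs_def image_iff)
  then show ?thesis by (simp add: out_degree_def card_image inj_on_def)
qed

lemma card_neighbours_le: "v \<in> pverts T \<Longrightarrow> card {w. (v, w) \<in> parcs T} \<le> max_degree T"
  unfolding max_degree_def out_degree_eq[symmetric] by (intro Max_ge) auto

lemma finite_neighbours: "finite {w. (v, w) \<in> parcs T}"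
  by (rule finite_subset[OF _ pair_finite_verts]) (auto dest: in_arcsD2)

end

text \<open>\<open>A\<close> and \<open>B\<close> stand for the traces of a convex set on the layer
  of \<open>T\<close> and on the layer of copies; each assumption comes from one kind of geodesic.
  Far vertices of \<open>T\<close> have distance 3 in the prism, also via their copies
  (\<open>A_far\<close>). An edge of \<open>T\<close> is a non-edge between copies, with the common
  non-neighbours as middle vertices (\<open>B_edge\<close>). Between \<open>v\<close> and the copy
  of \<open>w\<close>, the middle vertex is \<open>w\<close> or the copy of \<open>v\<close>,
  according to adjacency.\<close>

locale prism_convex = wide_graph +
  fixes A B :: "'a set"
  assumes A_sub: "A \<subseteq> pverts T" and B_sub: "B \<subseteq> pverts T"
    and A_middle: "\<lbrakk>u \<in> A; w \<in> A; u \<noteq> w; (u, x) \<in> parcs T; (x, w) \<in> parcs T\<rbrakk> \<Longrightarrow> x \<in> A"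
    and A_middle3: "\<lbrakk>u \<in> A; w \<in> A; far u w; (u, x) \<in> parcs T; (x, y) \<in> parcs T;
      (y, w) \<in> parcs T\<rbrakk> \<Longrightarrow> x \<in> A"
    and A_far: "\<lbrakk>u \<in> A; w \<in> A; far u w\<rbrakk> \<Longrightarrow> u \<in> B"
    and B_edge: "\<lbrakk>u \<in> B; w \<in> B; (u, w) \<in> parcs T; z \<in> pverts T; z \<noteq> u; z \<noteq> w;
      (u, z) \<notin> parcs T; (w, z) \<notin> parcs T\<rbrakk> \<Longrightarrow> z \<in> B"
    and cross_adj: "\<lbrakk>v \<in> A; w \<in> B; (v, w) \<in> parcs T\<rbrakk> \<Longrightarrow> w \<in> A"
    and cross_nonadj: "\<lbrakk>v \<in> A; w \<in> B; v \<noteq> w; (v, w) \<notin> parcs T\<rbrakk> \<Longrightarrow> v \<in> B"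
begin

section \<open>How membership spreads through the two layers\<close>

lemma finite_A: "finite A" and finite_B: "finite B"
  using A_sub B_sub finite_subset pair_finite_verts by blast+

text \<open>Take \<open>y\<close> far from the possibly missing \<open>x\<close>, and a neighbour
  \<open>y'\<close> of \<open>y\<close>. Both differ from \<open>x\<close> and are not adjacent to
  it, so \<open>B_edge\<close> for the edge \<open>yy'\<close> gives \<open>x\<close>.\<close>

lemma B_eq_verts_if_all_but_one:
  assumes "pverts T - {x} \<subseteq> B"
  shows "B = pverts T"
proof -
  have "x \<in> B" if x: "x \<in> pverts T"
  proof -
    obtain y where y: "y \<in> pverts T" "far x y" using ex_far[OF x] by blast
    obtain y' where y': "(y, y') \<in> parcs T" using ex_neighbour y by blast
    have "(y', y) \<in> parcs T" using y' arcs_symmetric by blast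
    then have nadj: "(x, y) \<notin> parcs T" "(x, y') \<notin> parcs T" "y \<noteq> x" "y' \<noteq> x"
      using y unfolding far_def by blast+
    then have "(y, x) \<notin> parcs T" "(y', x) \<notin> parcs T" using arcs_symmetric by blast+
    moreover have "y \<in> B" "y' \<in> B" using assms y y' in_arcsD2 nadj by blast+
    ultimately show ?thesis using B_edge y' x nadj by blast
  qed
  then show ?thesis using assms B_sub by blast
qed

lemma A_eq_verts:
  assumes "B = pverts T" "A \<noteq> {}"
  shows "A = pverts T"
  using A_sub assms(2)
proof (rule closed_eq_verts)
  fix u v assume "u \<in> A" "(u, v) \<in> parcs T"
  then show "v \<in> A" using cross_adj in_arcsD2 assms(1) by blast
qed

text \<open>The two edges at \<open>u\<close> first capture all non-neighbours of \<open>u\<close>.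
  An edge \<open>yy'\<close> among these then captures all neighbours of \<open>u\<close> but at
  most one.\<close>

lemma B_eq_verts_if_path:
  assumes "u \<in> B" "w \<in> B" "m \<in> B" "(u, w) \<in> parcs T" "(u, m) \<in> parcs T" "m \<noteq> w"
  shows "B = pverts T"
proof -
  have uV: "u \<in> pverts T" using assms(1) B_sub by blast
  have nonnbr: "z \<in> B" if z: "z \<in> pverts T" "(u, z) \<notin> parcs T" for z
  proof (cases "(m, z) \<in> parcs T")
    case False
    then show ?thesis using B_edge[of u m z] assms z by blast
  next
    case True
    show ?thesis
    proof (cases "z = u")
      case False
      \<comment> \<open>If \<open>z\<close> were adjacent to \<open>w\<close> as well as to
        \<open>m\<close>, then \<open>u\<close>, \<open>m\<close>, \<open>z\<close>,
        \<open>w\<close> would form a square; so the edge \<open>uw\<close> can replace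
        \<open>um\<close>.\<close>
      have "(z, m) \<in> parcs T" "(m, u) \<in> parcs T" "(w, u) \<in> parcs T"
        using True assms arcs_symmetric by blast+
      then have "(w, z) \<notin> parcs T"
        using no_square[of z m u w] False assms(6) arcs_symmetric by blast
      then show ?thesis using B_edge[of u w z] assms z False by blast
    qed (use assms in simp)
  qed
  obtain y where y: "y \<in> pverts T" "far u y" using ex_far[OF uV] by blast
  obtain y' where y': "(y, y') \<in> parcs T" using ex_neighbour y by blast
  have y'_sym: "(y', y) \<in> parcs T" using y' arcs_symmetric by blast
  have uy: "(u, y) \<notin> parcs T" "(u, y') \<notin> parcs T" "y \<noteq> u" "y' \<noteq> u"
    using y y'_sym unfolding far_def by blast+
  have yB: "y \<in> B" "y' \<in> B" using nonnbr y y' uy in_arcsD2 by blast+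
  have nbr: "x \<in> B" if x: "(u, x) \<in> parcs T" "(x, y') \<notin> parcs T" for x
  proof -
    have "(x, y) \<notin> parcs T" using x y unfolding far_def by blast
    then have "(y, x) \<notin> parcs T" "(y', x) \<notin> parcs T" using x arcs_symmetric by blast+
    moreover have "x \<in> pverts T" "x \<noteq> y" "x \<noteq> y'" using x uy in_arcsD2 by blast+
    ultimately show ?thesis using B_edge[of y y' x] yB y' by blast
  qed
  show ?thesis
  proof (cases "\<exists>c. (u, c) \<in> parcs T \<and> (c, y') \<in> parcs T")
    case True
    then obtain c where c: "(u, c) \<in> parcs T" "(c, y') \<in> parcs T" by blast
    \<comment> \<open>Without squares, \<open>c\<close> is the only common neighbour of
      \<open>u\<close> and \<open>y'\<close>.\<close>
    have "pverts T - {c} \<subseteq> B"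
    proof
      fix x assume x: "x \<in> pverts T - {c}"
      then have "\<not> ((u, x) \<in> parcs T \<and> (x, y') \<in> parcs T)"
        using no_square[of u c y' x] c uy by blast
      then show "x \<in> B" using nbr nonnbr x by blast
    qed
    then show ?thesis by (rule B_eq_verts_if_all_but_one)
  next
    case False
    then have "pverts T \<subseteq> B" using nbr nonnbr by blast
    then show ?thesis using B_sub by blast
  qed
qed

text \<open>
  The only convex sets with an edge \<open>uw\<close> in both layers, other than the whole prism, have
  \<open>A = {u, w}\<close> (such as in the path on six vertices, for its central edge).
\<close>

lemma A_eq_edge:
  assumes AB: "A \<subseteq> B" and uw: "u \<in> A" "w \<in> A" "(u, w) \<in> parcs T" and ne: "B \<noteq> pverts T"
  shows "A = {u, w}"
proof (rule ccontr)
  assume "A \<noteq> {u, w}"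
  then obtain z where z: "z \<in> A" "z \<noteq> u" "z \<noteq> w" using uw by blast
  have wu: "(w, u) \<in> parcs T" using uw arcs_symmetric by blast
  have "u \<noteq> w" using uw no_loops' by blast
  have uwB: "u \<in> B" "w \<in> B" using uw AB by blast+
  \<comment> \<open>A second neighbour in \<open>B\<close> would complete a path on three vertices
    in \<open>B\<close> and force \<open>B\<close> to be everything.\<close>
  have nbr_u: "m = w" if "(u, m) \<in> parcs T" "m \<in> B" for m
    using B_eq_verts_if_path[of u w m] uwB uw ne that by blast
  have nbr_w: "m = u" if "(w, m) \<in> parcs T" "m \<in> B" for m
    using B_eq_verts_if_path[of w u m] uwB wu ne that by blast
  have zB: "z \<in> B" using z AB by blast
  have nz: "(u, z) \<notin> parcs T" "(w, z) \<notin> parcs T" using nbr_u nbr_w z zB by blast+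
  \<comment> \<open>A common neighbour of \<open>u\<close> and \<open>z\<close> would lie in
    \<open>A\<close>, hence in \<open>B\<close>, hence be \<open>w\<close>, which is not adjacent to
    \<open>z\<close>.\<close>
  have "(x, z) \<notin> parcs T" if "(u, x) \<in> parcs T" for x
  proof
    assume xz: "(x, z) \<in> parcs T"
    then have "x \<in> B" using A_middle[of u z x] uw z that AB by blast
    then show False using nbr_u that xz nz by blast
  qed
  then have fu: "far u z" using nz z unfolding far_def by blast
  have "(x, z) \<notin> parcs T" if "(w, x) \<in> parcs T" for x
  proof
    assume xz: "(x, z) \<in> parcs T"
    then have "x \<in> B" using A_middle[of w z x] uw z that AB by blast
    then show False using nbr_w that xz nz by blast
  qed
  then have fw: "far w z" using nz z unfolding far_def by blast
  obtain z' where zz': "(z, z') \<in> parcs T" using ex_neighbour z A_sub by blast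
  have z'z: "(z', z) \<in> parcs T" using zz' arcs_symmetric by blast
  have z': "(u, z') \<notin> parcs T" "(w, z') \<notin> parcs T" "z' \<noteq> u" "z' \<noteq> w"
    using fu fw z'z nz unfolding far_def by blast+
  \<comment> \<open>Otherwise \<open>u\<close>, \<open>x\<close>, \<open>z'\<close>,
    \<open>z\<close> is a geodesic, as \<open>u\<close> and \<open>z\<close> are far; this again
    puts \<open>x\<close> in \<open>B\<close> and makes it equal to \<open>w\<close>.\<close>
  have "(x, z') \<notin> parcs T" if "(u, x) \<in> parcs T" for x
  proof
    assume xz: "(x, z') \<in> parcs T"
    then have "x \<in> B" using A_middle3[of u z x z'] uw z that AB fu z'z by blast
    then show False using nbr_u that xz z' by blast
  qed
  moreover have "(x, z') \<notin> parcs T" if "(w, x) \<in> parcs T" for x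
  proof
    assume xz: "(x, z') \<in> parcs T"
    then have "x \<in> B" using A_middle3[of w z x z'] uw z that AB fw z'z by blast
    then show False using nbr_w that xz z' by blast
  qed
  moreover have "z' \<in> pverts T" using zz' in_arcsD2 by blast
  ultimately have z'B: "z' \<in> B"
    and far': "\<And>x. (u, x) \<in> parcs T \<or> (w, x) \<in> parcs T \<Longrightarrow> (x, z') \<notin> parcs T"
    using B_edge[of u w z'] uwB uw z' by blast+
  \<comment> \<open>A neighbour of \<open>u\<close> or \<open>w\<close> is adjacent to neither end
    of \<open>zz'\<close>, and any other vertex outside \<open>{u, w}\<close> to neither end of
    \<open>uw\<close>. One of these two edges therefore captures it.\<close>
  have "x \<in> B" if x: "x \<in> pverts T" for x
  proof (cases "(u, x) \<in> parcs T \<or> (w, x) \<in> parcs T")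
    case True
    then have "(x, z) \<notin> parcs T" "(x, z') \<notin> parcs T"
      using far' fu fw unfolding far_def by blast+
    then have "(z, x) \<notin> parcs T" "(z', x) \<notin> parcs T" using arcs_symmetric by blast+
    moreover have "x \<noteq> z" "x \<noteq> z'" using True nz z' by blast+
    ultimately show ?thesis using B_edge[of z z' x] zB z'B zz' x by blast
  next
    case False
    then show ?thesis using B_edge[of u w x] uwB uw x by blast
  qed
  then show False using ne B_sub by blast
qed

section \<open>The upper bound in terms of the two layers\<close>

lemma card_A_le_if_independent:
  assumes AB: "A \<subseteq> B" and ind: "\<And>u w. \<lbrakk>u \<in> A; w \<in> A\<rbrakk> \<Longrightarrow> (u, w) \<notin> parcs T"
  shows "card A \<le> card (pverts T - B)"
proof -
  have "\<exists>f. \<forall>a\<in>A. (a, f a) \<in> parcs T" using ex_neighbour A_sub by (intro bchoice) blast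
  then obtain f where f: "\<And>a. a \<in> A \<Longrightarrow> (a, f a) \<in> parcs T" by blast
  \<comment> \<open>A shared neighbour of two members of \<open>A\<close> would lie between them,
    hence in \<open>A\<close>, against independence.\<close>
  have "inj_on f A"
  proof (rule inj_onI, rule ccontr)
    fix a b assume ab: "a \<in> A" "b \<in> A" "f a = f b" "a \<noteq> b"
    have "(f a, b) \<in> parcs T" using f[of b] ab arcs_symmetric by metis
    then have "f a \<in> A" using A_middle[of a b "f a"] ab f by blast
    then show False using ind f ab by blast
  qed
  \<comment> \<open>If \<open>f a\<close> were in \<open>B\<close>, then \<open>cross_adj\<close>
    would put it in \<open>A\<close> next to \<open>a\<close>.\<close>
  moreover have "f ` A \<subseteq> pverts T - B"
    using f in_arcsD2 cross_adj ind by blast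
  ultimately show ?thesis by (intro card_inj_on_le) auto
qed

lemma card_le_if_subset:
  assumes AB: "A \<subseteq> B" and ne: "\<not> (A = pverts T \<and> B = pverts T)"
  shows "card A + card B \<le> card (pverts T)"
proof (cases "A = {}")
  case True
  then show ?thesis using B_sub by (simp add: card_mono)
next
  case False
  then have BV: "B \<noteq> pverts T" using A_eq_verts ne by blast
  have "card A \<le> card (pverts T - B)"
  proof (cases "\<exists>u\<in>A. \<exists>w\<in>A. (u, w) \<in> parcs T")
    case True
    then obtain u w where "A = {u, w}" using A_eq_edge[OF AB _ _ _ BV] by blast
    then have "card A \<le> 2" by (simp add: card_insert_if)
    moreover have "2 \<le> card (pverts T - B)"
    proof (rule ccontr)
      assume "\<not> ?thesis"
      then consider "card (pverts T - B) = 0" | "card (pverts T - B) = 1" by linarith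
      then have "\<exists>x. pverts T - {x} \<subseteq> B"
        by cases (auto simp: card_1_singleton_iff)
      then show False using B_eq_verts_if_all_but_one BV by blast
    qed
    ultimately show ?thesis by linarith
  next
    case False
    then show ?thesis using card_A_le_if_independent[OF AB] by blast
  qed
  then show ?thesis using B_sub finite_B card_mono[OF pair_finite_verts B_sub]
    by (simp add: card_Diff_subset)
qed

lemma card_le_if_not_subset:
  assumes a: "a \<in> A" "a \<notin> B"
  shows "card A + card B \<le> max (card (pverts T)) (2 * max_degree T + 1)"
proof (cases "card B \<le> 1")
  case True
  show ?thesis
  proof (cases "A = pverts T")
    case A: True
    \<comment> \<open>With all of \<open>T\<close> in \<open>A\<close>, a vertex far from
      \<open>a\<close> would force \<open>a\<close> into \<open>B\<close>. So \<open>A\<close>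
      misses a vertex, which makes up for the single element \<open>B\<close> may have.\<close>
    obtain y where y: "y \<in> pverts T" "far a y" using ex_far a A_sub by blast
    then show ?thesis using A_far[of a y] a A by blast
  next
    case False
    then have "card A < card (pverts T)" using A_sub by (intro psubset_card_mono) auto
    then show ?thesis using True by linarith
  qed
next
  case False
  have nbr: "B \<subseteq> {w. (c, w) \<in> parcs T}" if "c \<in> A" "c \<notin> B" for c
    using that cross_nonadj by blast
  obtain b b' where b: "b \<in> B" "b' \<in> B" "b \<noteq> b'"
    using False finite_B card_le_Suc0_iff_eq[of B] by (auto simp: not_le)
  \<comment> \<open>Both \<open>c\<close> and \<open>a\<close> are adjacent to \<open>b\<close> and
    \<open>b'\<close>, so distinct ones would give a square.\<close>
  have "c = a" if c: "c \<in> A" "c \<notin> B" for c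
  proof (rule ccontr)
    assume "c \<noteq> a"
    moreover have "(c, b) \<in> parcs T" "(c, b') \<in> parcs T" "(b, a) \<in> parcs T" "(b', a) \<in> parcs T"
      using nbr[OF c] nbr[OF a] b arcs_symmetric by blast+
    ultimately show False using no_square b by blast
  qed
  then have "A \<subseteq> insert a B" by blast
  then have "card A \<le> Suc (card B)"
    using card_mono[of "insert a B" A] finite_B a by simp
  moreover have "card B \<le> max_degree T"
    using card_mono[OF finite_neighbours nbr[OF a]] card_neighbours_le[of a] a A_sub by fastforce
  ultimately show ?thesis by linarith
qed

lemma card_le:
  assumes "\<not> (A = pverts T \<and> B = pverts T)"
  shows "card A + card B \<le> max (card (pverts T)) (2 * max_degree T + 1)"
proof (cases "A \<subseteq> B")
  case True
  then show ?thesis using card_le_if_subset assms by (simp add: le_max_iff_disj)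
next
  case False
  then show ?thesis using card_le_if_not_subset by blast
qed

end

section \<open>The complementary prism\<close>

lemma pverts_complementary_prism:
  "pverts (complementary_prism G) = pverts G <+> pverts G"
  by (simp add: complementary_prism_def graph_complement_def)

lemma parcs_complementary_prism [simp]:
  "(Inl u, Inl v) \<in> parcs (complementary_prism G) \<longleftrightarrow> (u, v) \<in> parcs G"
  "(Inr u, Inr v) \<in> parcs (complementary_prism G) \<longleftrightarrow>
     u \<in> pverts G \<and> v \<in> pverts G \<and> u \<noteq> v \<and> (u, v) \<notin> parcs G"
  "(Inl u, Inr v) \<in> parcs (complementary_prism G) \<longleftrightarrow> u = v \<and> u \<in> pverts G"
  "(Inr u, Inl v) \<in> parcs (complementary_prism G) \<longleftrightarrow> u = v \<and> u \<in> pverts G"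
  by (force simp: complementary_prism_def graph_complement_def)+

context wide_graph
begin

sublocale prism: pair_graph "complementary_prism T"
  by (rule pair_graph_complementary_prism) (rule pair_graph)

lemma prism_convex_if_convex:
  assumes S: "geodesically_convex (complementary_prism T) S"
  shows "prism_convex T {v. Inl v \<in> S} {v. Inr v \<in> S}"
proof -
  let ?P = "complementary_prism T"
  note mid = prism.geodesically_convex_middle[OF S]
  note mid3 = prism.geodesically_convex_middle3[OF S]
  have sub: "S \<subseteq> pverts T <+> pverts T"
    using S by (simp add: geodesically_convex_def pverts_complementary_prism)
  \<comment> \<open>A copy has only one neighbour in the layer of \<open>T\<close>, so a path of
    length 2 between distinct vertices of that layer stays in it.\<close>
  have far_prism: "(Inl u, z) \<notin> parcs ?P \<or> (z, Inl w) \<notin> parcs ?P" if "far u w" for u w z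
    using that by (cases z) (auto simp: far_def)
  show ?thesis
  proof unfold_locales
    show "{v. Inl v \<in> S} \<subseteq> pverts T" "{v. Inr v \<in> S} \<subseteq> pverts T" using sub by auto
  next
    fix u w x assume "u \<in> {v. Inl v \<in> S}" "w \<in> {v. Inl v \<in> S}" "u \<noteq> w"
      and "(u, x) \<in> parcs T" "(x, w) \<in> parcs T"
    then show "x \<in> {v. Inl v \<in> S}"
      using mid[of "Inl u" "Inl w" "Inl x"] no_triangle by auto
  next
    fix u w x y assume "u \<in> {v. Inl v \<in> S}" "w \<in> {v. Inl v \<in> S}" "far u w"
      and "(u, x) \<in> parcs T" "(x, y) \<in> parcs T" "(y, w) \<in> parcs T"
    then show "x \<in> {v. Inl v \<in> S}"
      using mid3[of "Inl u" "Inl w" "Inl x" "Inl y"] far_prism by (auto simp: far_def)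
  next
    fix u w assume *: "u \<in> {v. Inl v \<in> S}" "w \<in> {v. Inl v \<in> S}" "far u w"
    then have "u \<in> pverts T" "w \<in> pverts T" using sub by auto
    \<comment> \<open>The detour \<open>Inl u\<close>, \<open>Inr u\<close>, \<open>Inr w\<close>,
      \<open>Inl w\<close> has length 3 and is thus a geodesic.\<close>
    then show "u \<in> {v. Inr v \<in> S}"
      using * mid3[of "Inl u" "Inl w" "Inr u" "Inr w"] far_prism by (auto simp: far_def)
  next
    fix u w z assume "u \<in> {v. Inr v \<in> S}" "w \<in> {v. Inr v \<in> S}" "(u, w) \<in> parcs T"
      and "z \<in> pverts T" "z \<noteq> u" "z \<noteq> w" "(u, z) \<notin> parcs T" "(w, z) \<notin> parcs T"
    then show "z \<in> {v. Inr v \<in> S}"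
      using mid[of "Inr u" "Inr w" "Inr z"] arcs_symmetric no_loops' in_arcsD1 in_arcsD2 by auto
  next
    fix v w assume "v \<in> {v. Inl v \<in> S}" "w \<in> {v. Inr v \<in> S}" "(v, w) \<in> parcs T"
    then show "w \<in> {v. Inl v \<in> S}"
      using mid[of "Inl v" "Inr w" "Inl w"] no_loops' in_arcsD2 by auto
  next
    fix v w assume "v \<in> {v. Inl v \<in> S}" "w \<in> {v. Inr v \<in> S}" "v \<noteq> w" "(v, w) \<notin> parcs T"
    then show "v \<in> {v. Inr v \<in> S}"
      using mid[of "Inl v" "Inr w" "Inr v"] sub by auto
  qed
qed

lemma card_convex_le:
  assumes S: "geodesically_convex (complementary_prism T) S"
    and ne: "S \<noteq> pverts (complementary_prism T)"
  shows "card S \<le> max (card (pverts T)) (2 * max_degree T + 1)"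
proof -
  let ?A = "{v. Inl v \<in> S}" and ?B = "{v. Inr v \<in> S}"
  interpret prism_convex T ?A ?B by (rule prism_convex_if_convex[OF S])
  have eq: "S = ?A <+> ?B"
  proof (rule set_eqI)
    fix x show "x \<in> S \<longleftrightarrow> x \<in> ?A <+> ?B" by (cases x) auto
  qed
  have "card S = card ?A + card ?B"
    by (subst eq) (rule card_Plus[OF finite_A finite_B])
  moreover have "\<not> (?A = pverts T \<and> ?B = pverts T)"
    using ne eq unfolding pverts_complementary_prism by metis
  ultimately show ?thesis using card_le by simp
qed

section \<open>Two convex sets attaining the bounds\<close>

lemma convex_complement_layer:
  "geodesically_convex (complementary_prism T) ({} <+> pverts T)"
proof (rule prism.geodesically_convexI)
  fix u v assume u: "u \<in> {} <+> pverts T" and v: "v \<in> {} <+> pverts T" and "u \<noteq> v"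
    and nadj: "(u, v) \<notin> parcs (complementary_prism T)"
  obtain a b where ab: "u = Inr a" "v = Inr b" "a \<in> pverts T" "b \<in> pverts T" using u v by auto
  then have adj: "(a, b) \<in> parcs T" "a \<noteq> b" using nadj \<open>u \<noteq> v\<close> by auto
  \<comment> \<open>Being far from \<open>a\<close>, \<open>z\<close> is adjacent neither to
    \<open>a\<close> nor to its neighbour \<open>b\<close>; its copy joins theirs.\<close>
  obtain z where z: "z \<in> pverts T" "far a z" using ex_far ab by blast
  have "(a, z) \<notin> parcs T" "(b, z) \<notin> parcs T" "a \<noteq> z" "b \<noteq> z"
    using z adj unfolding far_def by blast+
  moreover from this have "(z, b) \<notin> parcs T" using arcs_symmetric by blast
  ultimately have "(u, Inr z) \<in> parcs (complementary_prism T)"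
    "(Inr z, v) \<in> parcs (complementary_prism T)"
    using ab z by auto
  then show "\<exists>x. (u, x) \<in> parcs (complementary_prism T) \<and> (x, v) \<in> parcs (complementary_prism T)"
    by blast
next
  fix u v x assume "u \<in> {} <+> pverts T" "v \<in> {} <+> pverts T" "u \<noteq> v"
    "(u, x) \<in> parcs (complementary_prism T)" "(x, v) \<in> parcs (complementary_prism T)"
  then show "x \<in> {} <+> pverts T" by (cases x) auto
qed (auto simp: pverts_complementary_prism)

text \<open>The neighbours of \<open>v\<close> are independent, so their copies form a clique. The
  copy of \<open>v\<close> stays outside, which accounts for the odd cardinality.\<close>

lemma convex_star:
  assumes v: "v \<in> pverts T"
  defines "N \<equiv> {w. (v, w) \<in> parcs T}"
  shows "geodesically_convex (complementary_prism T) (insert v N <+> N)"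
proof (rule prism.geodesically_convexI)
  have NV: "N \<subseteq> pverts T" using in_arcsD2 by (auto simp: N_def)
  then show "insert v N <+> N \<subseteq> pverts (complementary_prism T)"
    using v by (auto simp: pverts_complementary_prism)
  let ?P = "complementary_prism T"
  have ind: "(a, b) \<notin> parcs T" if "a \<in> N" "b \<in> N" for a b
    using that no_triangle unfolding N_def by blast
  have N: "(v, a) \<in> parcs T" "(a, v) \<in> parcs T" "a \<noteq> v" if "a \<in> N" for a
    using that arcs_symmetric no_loops' unfolding N_def by blast+
  fix x y assume x: "x \<in> insert v N <+> N" and y: "y \<in> insert v N <+> N"
    and ne: "x \<noteq> y" and nadj: "(x, y) \<notin> parcs ?P"
  consider
      (ll) a b where "x = Inl a" "y = Inl b" "a \<in> insert v N" "b \<in> insert v N"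
    | (lr) a b where "x = Inl a" "y = Inr b" "a \<in> insert v N" "b \<in> N"
    | (rl) a b where "x = Inr a" "y = Inl b" "a \<in> N" "b \<in> insert v N"
    | (rr) a b where "x = Inr a" "y = Inr b" "a \<in> N" "b \<in> N"
    using x y by blast
  note cases = this
  show "\<exists>z. (x, z) \<in> parcs ?P \<and> (z, y) \<in> parcs ?P"
    using cases
  proof cases
    case ll
    then have "a \<in> N" "b \<in> N" using ne nadj N by auto
    then show ?thesis using ll N by (intro exI[of _ "Inl v"]) simp
  next
    case lr
    show ?thesis
    proof (cases "a = v")
      case True
      then show ?thesis using lr N NV by (intro exI[of _ "Inl b"]) auto
    next
      case False
      then show ?thesis using lr NV ind nadj by (intro exI[of _ "Inr a"]) auto
    qed
  next
    case rl
    show ?thesis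
    proof (cases "b = v")
      case True
      then show ?thesis using rl N NV by (intro exI[of _ "Inl a"]) auto
    next
      case False
      then show ?thesis using rl NV ind nadj by (intro exI[of _ "Inr b"]) auto
    qed
  next
    case rr
    then show ?thesis using ne nadj NV ind by auto
  qed
  fix z assume z: "(x, z) \<in> parcs ?P" "(z, y) \<in> parcs ?P"
  show "z \<in> insert v N <+> N"
    using cases
  proof cases
    case ll
    then have ab: "a \<in> N" "b \<in> N" "a \<noteq> b" using ne nadj N by auto
    show ?thesis
    proof (cases z)
      case (Inl c)
      \<comment> \<open>Two neighbours of \<open>v\<close> have no other common neighbour, as there
        are no squares.\<close>
      then have "c = v"
        using no_square[of a c b v] ll ab z N by auto
      then show ?thesis using Inl by blast
    qed (use ll z ab in auto)
  next
    case lr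
    show ?thesis
    proof (cases z)
      case (Inr c)
      \<comment> \<open>A middle vertex among the copies is that of \<open>a\<close>; since
        \<open>a\<close> is not adjacent to \<open>b\<close>, it is not \<open>v\<close> and so
        belongs to \<open>N\<close>.\<close>
      then have "c = a" "(a, b) \<notin> parcs T" using lr z by auto
      then show ?thesis using lr Inr N(1)[of b] by blast
    qed (use lr z in auto)
  next
    case rl
    show ?thesis
    proof (cases z)
      case (Inr c)
      then have "c = b" "(a, b) \<notin> parcs T" using rl z by auto
      then show ?thesis using rl Inr N(2)[of a] by blast
    qed (use rl z in auto)
  next
    case rr
    then show ?thesis using ne nadj NV ind by auto
  qed
qed

theorem convexity_number_complementary_prism:
  "convexity_number (complementary_prism T) = max (card (pverts T)) (2 * max_degree T + 1)"
proof -
  let ?P = "complementary_prism T"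
  let ?C = "{card S | S. geodesically_convex ?P S \<and> S \<noteq> pverts ?P}"
  have fin: "finite ?C"
    by (rule finite_subset[of _ "card ` Pow (pverts ?P)"])
       (auto simp: geodesically_convex_def)
  have upper: "k \<le> max (card (pverts T)) (2 * max_degree T + 1)" if "k \<in> ?C" for k
    using that card_convex_le by blast
  have "({} :: 'a set) <+> pverts T \<noteq> pverts ?P"
    using nonempty by (auto simp: pverts_complementary_prism)
  moreover have "card (({} :: 'a set) <+> pverts T) = card (pverts T)"
    by (simp add: card_Plus)
  ultimately have layer: "card (pverts T) \<in> ?C" using convex_complement_layer by force
  have "max_degree T \<in> (\<lambda>v. out_degree (with_proj T) v) ` pverts T"
    unfolding max_degree_def using nonempty by (intro Max_in) auto
  then obtain v where v: "v \<in> pverts T" "max_degree T = card {w. (v, w) \<in> parcs T}"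
    by (auto simp: out_degree_eq)
  let ?N = "{w. (v, w) \<in> parcs T}"
  have vN: "v \<notin> ?N" using no_loops' by blast
  then have "card (insert v ?N <+> ?N) = 2 * max_degree T + 1"
    using v finite_neighbours by (simp add: card_Plus)
  \<comment> \<open>The copy of \<open>v\<close> witnesses that the star is a proper subset.\<close>
  moreover have "Inr v \<in> pverts ?P" "Inr v \<notin> insert v ?N <+> ?N"
    using v vN by (auto simp: pverts_complementary_prism)
  then have "insert v ?N <+> ?N \<noteq> pverts ?P" by blast
  ultimately have star: "2 * max_degree T + 1 \<in> ?C" using convex_star[OF v(1)] by force
  have "max (card (pverts T)) (2 * max_degree T + 1) \<in> ?C"
    using layer star by (simp only: max_def split: if_split) blast
  then show ?thesis unfolding convexity_number_def using fin upper by (intro Max_eqI)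
qed

end

section \<open>From trees of large diameter to wide graphs\<close>

lemma wide_graph_if_simple_tree:
  assumes tree: "simple_tree T" and diam: "5 \<le> graph_diam T"
  shows "wide_graph T"
proof -
  interpret pair_graph T using tree by (simp add: simple_tree_def)
  have conn: "Digraph_Component.connected (with_proj T)"
    and acyc: "\<And>p. cycle p \<Longrightarrow> length p < 3"
    using tree by (auto simp: simple_tree_def not_le)
  have sc: "strongly_connected (with_proj T)"
    using conn symmetric_connected_imp_strongly_connected by blast
  show ?thesis
  proof unfold_locales
    fix u v assume "u \<in> pverts T" "v \<in> pverts T"
    then show "u \<rightarrow>\<^sup>*\<^bsub>with_proj T\<^esub> v" using sc by (simp add: strongly_connected_def)
  next
    show "pverts T \<noteq> {}" using sc by (simp add: strongly_connected_def)
  next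
    fix a b c assume ab: "(a, b) \<in> parcs T" and bc: "(b, c) \<in> parcs T"
    show "(a, c) \<notin> parcs T"
    proof
      assume "(a, c) \<in> parcs T"
      then have "(c, a) \<in> parcs T" using arcs_symmetric by blast
      \<comment> \<open>A triangle is a cycle of length exactly 3, the shortest that
        \<open>simple_tree\<close> forbids.\<close>
      then have "cycle [(a, b), (b, c), (c, a)]"
        using ab bc no_loops' in_arcsD1
        by (auto simp: cycle_def awalk_simps intro!: exI[of _ a])
      then show False using acyc by fastforce
    qed
  next
    fix a b c d assume ab: "(a, b) \<in> parcs T" and bc: "(b, c) \<in> parcs T"
      and ad: "(a, d) \<in> parcs T" and dc: "(d, c) \<in> parcs T" and "a \<noteq> c"
    show "b = d"
    proof (rule ccontr)
      assume "b \<noteq> d"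
      moreover have "(c, d) \<in> parcs T" "(d, a) \<in> parcs T" using ad dc arcs_symmetric by blast+
      ultimately have "cycle [(a, b), (b, c), (c, d), (d, a)]"
        using ab bc \<open>a \<noteq> c\<close> no_loops' in_arcsD1
        by (auto simp: cycle_def awalk_simps intro!: exI[of _ a])
      then show False using acyc by fastforce
    qed
  next
    fix x assume "x \<in> pverts T"
    then show "\<exists>y\<in>pverts T. far x y" by (rule ex_far_if_diam[OF diam])
  qed
qed

theorem theorem3p7:
  fixes T :: "'a pair_pre_digraph"
  assumes "simple_tree T"
    and "5 \<le> graph_diam T"
  shows "convexity_number (complementary_prism T) = max (card (pverts T)) (2 * max_degree T + 1)"
  using wide_graph.convexity_number_complementary_prism[OF wide_graph_if_simple_tree[OF assms]] .

end
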